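(* Let $0<\lambda_p<\mu$, $\sigma\ge 0$, $a,b,c>0$, $\psi=(1+\sigma^2\mu^2)/2$, and assume $\frac{a}{c}>\frac{\lambda_p(2\mu-\lambda_p)}{\mu(\mu-\lambda_p)^2}\psi$. Let $I^-=(\hat S_p,I_l)$, and let P0, P1, P2 be the optimization problems (depending on $S_p$) defined in the context, with $O_1^*$ and $O_2^*$ the optimal values of P1 and P2. Then for every $S_p\in I^-$ the optimal solution of P0 is given by the optimal solution of P1. That is, $O_1^*>O_2^*$, P1 has an optimal solution $(\lambda_s^*,\beta^* )$, and, setting $S_s^*=W_s(\lambda_s^*,\beta^* )$ and $\theta^*=(a-\lambda_s^*-cS_s^* )/b$, the tuple $(\lambda_s^*,\beta^*,S_s^*,\theta^* )$ is an optimal solution of P0.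
   Context: Setting: a single-server M/G/1 queue with two customer classes, primary (Poisson arrival rate $\lambda_p$) and secondary (Poisson arrival rate $\lambda_s$), with i.i.d. service times of mean $1/\mu$ and variance $\sigma^2$ for both classes. The queue is operated under the non-preemptive delay dependent priority discipline with parameter $\beta\in[0,\infty]$ ($\beta=0$: static high priority to primary; $\beta=1$: FCFS; $\beta=\infty$: static high priority to secondary). For $0\le\lambda_s<\mu-\lambda_p$ and $\lambda=\lambda_p+\lambda_s$, the mean waiting times are $W_p(\lambda_s,\beta)=\frac{\lambda\psi(\mu-\lambda(1-\beta))}{\mu(\mu-\lambda)(\mu-\lambda_p(1-\beta))}$ and $W_s(\lambda_s,\beta)=\frac{\lambda\psi}{(\mu-\lambda)(\mu-\lambda_p(1-\beta))}$ if $0\le\beta\le1$; $W_p(\lambda_s,\beta)=\frac{\lambda\psi}{(\mu-\lambda)(\mu-\lambda_s(1-1/\beta))}$ and $W_s(\lambda_s,\beta)=\frac{\lambda\psi(\mu-\lambda(1-1/\beta))}{\mu(\mu-\lambda)(\mu-\lambda_s(1-1/\beta))}$ if $1<\beta\le\infty$ (with $1/\infty=0$). Problems, for a given $S_p>0$ (stability requires $\lambda_s<\mu-\lambda_p$, so that waiting times are finite): P0: maximize $\theta\lambda_s$ over $(\lambda_s,\beta,S_s,\theta)$ subject to $W_p(\lambda_s,\beta)\le S_p$, $W_s(\lambda_s,\beta)\le S_s$, $0\le\lambda_s<\mu-\lambda_p$, $\lambda_s\le a-b\theta-cS_s$, $\theta\ge0$, $S_s\ge0$, $\beta\in[0,\infty]$.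 P1: maximize $\frac1b\left(a\lambda_s-\lambda_s^2-c\lambda_sW_s(\lambda_s,\beta)\right)$ over $(\lambda_s,\beta)$ subject to $W_p(\lambda_s,\beta)\le S_p$, $0\le\lambda_s<\mu-\lambda_p$, $\beta\in[0,\infty)$. P2: maximize $\frac1b\left(a\lambda_s-\lambda_s^2-c\lambda_sW_s(\lambda_s,\infty)\right)$ over $\lambda_s$ subject to $W_p(\lambda_s,\infty)\le S_p$, $0\le\lambda_s<\mu-\lambda_p$. Interval: $\hat S_p=\frac{\lambda_p\psi}{\mu(\mu-\lambda_p)}$ and $I_l=\frac{\lambda_1\psi}{\mu(\mu-\lambda_p)}$ with $\lambda_1=\lambda_p+\lambda_s^{(1)}$, where $\lambda_s^{(1)}$ is the unique root in $(0,\mu-\lambda_p)$ of the cubic, with $\phi_0=\mu-\lambda_p$, $G(\lambda_s)=2\mu\lambda_s^3-[c\psi+\mu(a+4\phi_0)]\lambda_s^2+2\phi_0[c\psi+\mu(a+\phi_0)]\lambda_s-a\mu\phi_0^2+c\psi\lambda_p(\mu+\phi_0)$. *)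

theory Defs
  imports Complex_Main "HOL-Library.Extended_Real"
begin

text \<open>
  Two-class M/G/1 queue under the non-preemptive delay dependent priority discipline.
  Throughout, \<open>mu\<close> is the service rate, \<open>sigma\<close> the standard deviation of the service times,
  \<open>lp\<close> and \<open>ls\<close> are the arrival rates of the primary and of the secondary class, and
  \<open>a\<close>, \<open>b\<close>, \<open>c\<close> are the coefficients of the linear demand bound.  The scheduling parameter
  \<open>\<beta> \<in> [0, \<infinity>]\<close> is an extended real; since \<open>1 / (\<infinity> :: ereal) = 0\<close>, the formulas for \<open>\<beta> > 1\<close>
  cover \<open>\<beta> = \<infinity>\<close> with the intended convention.
\<close>

definition psi :: "real \<Rightarrow> real \<Rightarrow> real" where
  "psi mu sigma = (1 + sigma\<^sup>2 * mu\<^sup>2) / 2"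

definition W_p :: "real \<Rightarrow> real \<Rightarrow> real \<Rightarrow> real \<Rightarrow> ereal \<Rightarrow> real" where
  "W_p mu sigma lp ls \<beta> =
     (let l = lp + ls in
      if \<beta> \<le> 1 then
        l * psi mu sigma * (mu - l * (1 - real_of_ereal \<beta>)) /
          (mu * (mu - l) * (mu - lp * (1 - real_of_ereal \<beta>)))
      else
        l * psi mu sigma / ((mu - l) * (mu - ls * (1 - real_of_ereal (1 / \<beta>)))))"

definition W_s :: "real \<Rightarrow> real \<Rightarrow> real \<Rightarrow> real \<Rightarrow> ereal \<Rightarrow> real" where
  "W_s mu sigma lp ls \<beta> =
     (let l = lp + ls in
      if \<beta> \<le> 1 then
        l * psi mu sigma / ((mu - l) * (mu - lp * (1 - real_of_ereal \<beta>)))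
      else
        l * psi mu sigma * (mu - l * (1 - real_of_ereal (1 / \<beta>))) /
          (mu * (mu - l) * (mu - ls * (1 - real_of_ereal (1 / \<beta>)))))"

text \<open>
  Points of the problem \<open>P0\<close> are tuples \<open>(ls, \<beta>, Ss, \<theta>)\<close>, where \<open>Ss\<close> is the service level
  (mean waiting time) offered to the secondary class and \<open>\<theta>\<close> its unit admission price.
\<close>

definition P0_objective :: "real \<times> ereal \<times> real \<times> real \<Rightarrow> real" where
  "P0_objective = (\<lambda>(ls, \<beta>, Ss, \<theta>). \<theta> * ls)"

definition P0_feasible ::
  "real \<Rightarrow> real \<Rightarrow> real \<Rightarrow> real \<Rightarrow> real \<Rightarrow> real \<Rightarrow> real \<Rightarrow> (real \<times> ereal \<times> real \<times> real) set" where
  "P0_feasible mu sigma lp a b c Sp =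
     {(ls, \<beta>, Ss, \<theta>). W_p mu sigma lp ls \<beta> \<le> Sp \<and> W_s mu sigma lp ls \<beta> \<le> Ss \<and>
        0 \<le> ls \<and> ls < mu - lp \<and> ls \<le> a - b * \<theta> - c * Ss \<and>
        0 \<le> \<theta> \<and> 0 \<le> Ss \<and> 0 \<le> \<beta> \<and> \<beta> \<le> \<infinity>}"

definition P1_objective ::
  "real \<Rightarrow> real \<Rightarrow> real \<Rightarrow> real \<Rightarrow> real \<Rightarrow> real \<Rightarrow> real \<times> ereal \<Rightarrow> real" where
  "P1_objective mu sigma lp a b c =
     (\<lambda>(ls, \<beta>). 1 / b * (a * ls - ls\<^sup>2 - c * ls * W_s mu sigma lp ls \<beta>))"

definition P1_feasible :: "real \<Rightarrow> real \<Rightarrow> real \<Rightarrow> real \<Rightarrow> (real \<times> ereal) set" where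
  "P1_feasible mu sigma lp Sp =
     {(ls, \<beta>). W_p mu sigma lp ls \<beta> \<le> Sp \<and> 0 \<le> ls \<and> ls < mu - lp \<and> 0 \<le> \<beta> \<and> \<beta> < \<infinity>}"

definition P2_objective ::
  "real \<Rightarrow> real \<Rightarrow> real \<Rightarrow> real \<Rightarrow> real \<Rightarrow> real \<Rightarrow> real \<Rightarrow> real" where
  "P2_objective mu sigma lp a b c ls =
     1 / b * (a * ls - ls\<^sup>2 - c * ls * W_s mu sigma lp ls \<infinity>)"

definition P2_feasible :: "real \<Rightarrow> real \<Rightarrow> real \<Rightarrow> real \<Rightarrow> real set" where
  "P2_feasible mu sigma lp Sp =
     {ls. W_p mu sigma lp ls \<infinity> \<le> Sp \<and> 0 \<le> ls \<and> ls < mu - lp}"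

text \<open>
  The optimal value of a maximization problem is the supremum of the objective over the
  feasible set, whether or not it is attained; it is taken in \<open>ereal\<close>, so that it is meaningful
  also for unbounded and for infeasible problems.
\<close>

definition optimal_value :: "('x \<Rightarrow> real) \<Rightarrow> 'x set \<Rightarrow> ereal" where
  "optimal_value f X = (SUP x\<in>X. ereal (f x))"

definition optimal_solution :: "('x \<Rightarrow> real) \<Rightarrow> 'x set \<Rightarrow> 'x \<Rightarrow> bool" where
  "optimal_solution f X x \<longleftrightarrow> is_arg_max f (\<lambda>y. y \<in> X) x"

definition S_hat :: "real \<Rightarrow> real \<Rightarrow> real \<Rightarrow> real" where
  "S_hat mu sigma lp = lp * psi mu sigma / (mu * (mu - lp))"

definition G :: "real \<Rightarrow> real \<Rightarrow> real \<Rightarrow> real \<Rightarrow> real \<Rightarrow> real \<Rightarrow> real" where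
  "G mu sigma lp a c x =
     (let \<phi>\<^sub>0 = mu - lp; \<psi> = psi mu sigma in
      2 * mu * x ^ 3 - (c * \<psi> + mu * (a + 4 * \<phi>\<^sub>0)) * x\<^sup>2
        + 2 * \<phi>\<^sub>0 * (c * \<psi> + mu * (a + \<phi>\<^sub>0)) * x
        - a * mu * \<phi>\<^sub>0\<^sup>2 + c * \<psi> * lp * (mu + \<phi>\<^sub>0))"

text \<open>
  The definite description is well defined as soon as \<open>G\<close> is negative at \<open>0\<close>, that is, for
  \<open>a / c > lp * (2 * mu - lp) * psi mu sigma / (mu * (mu - lp)\<^sup>2)\<close>: then \<open>G\<close> is positive at
  \<open>mu - lp\<close>, where its derivative vanishes, so that \<open>G\<close> has exactly one root in between.
\<close>

definition ls1 :: "real \<Rightarrow> real \<Rightarrow> real \<Rightarrow> real \<Rightarrow> real \<Rightarrow> real" where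
  "ls1 mu sigma lp a c = (THE x. 0 < x \<and> x < mu - lp \<and> G mu sigma lp a c x = 0)"

definition I_l :: "real \<Rightarrow> real \<Rightarrow> real \<Rightarrow> real \<Rightarrow> real \<Rightarrow> real" where
  "I_l mu sigma lp a c = (lp + ls1 mu sigma lp a c) * psi mu sigma / (mu * (mu - lp))"

definition I_minus :: "real \<Rightarrow> real \<Rightarrow> real \<Rightarrow> real \<Rightarrow> real \<Rightarrow> real set" where
  "I_minus mu sigma lp a c = {S_hat mu sigma lp <..< I_l mu sigma lp a c}"

end

theory Submission
  imports Defs
begin

text \<open>
  The conservation law says that \<open>lp * W_p + ls * W_s\<close> does not depend on \<open>\<beta>\<close>. It turns \<open>b\<close> times
  the revenue into \<open>F ls + c * lp * W_p\<close>, where \<open>F\<close> is \<open>revenue_base\<close> below, and \<open>W_p \<le> Sp\<close> bounds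
  this by \<open>F ls + c * lp * Sp\<close>. On \<open>[0, mu - lp)\<close> the sign of the slope of \<open>F\<close> is that of \<open>- G\<close>, so
  \<open>F\<close> increases up to the root of \<open>G\<close>. Moreover \<open>W_p\<close> is smallest at \<open>\<beta> = 0\<close>, so \<open>W_p \<le> Sp\<close>
  forces \<open>ls \<le> s\<close>, where \<open>s\<close> is the rate at which \<open>W_p\<close> equals \<open>Sp\<close> for \<open>\<beta> = 0\<close>; since \<open>Sp < I_l\<close>,
  this \<open>s\<close> lies below the root of \<open>G\<close>. Hence \<open>(s, 0)\<close> is optimal even among all \<open>\<beta> \<in> [0, \<infinity>]\<close>, while
  at \<open>\<beta> = \<infinity>\<close> the constraint keeps \<open>ls\<close> away from \<open>s\<close>.
\<close>

section \<open>Signs and the range of the scheduling parameter\<close>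

lemma psi_pos: "psi mu sigma > 0"
  unfolding psi_def by (simp add: add_pos_nonneg)

text \<open>In each branch the waiting times depend on \<beta> only through a real \<open>t\<close>
  in [0, 1]. Passing to \<open>t\<close> keeps extended reals, and \<infinity> in particular, out of
  the later calculations.\<close>

lemma parameter_cases:
  fixes \<beta> :: ereal
  assumes "0 \<le> \<beta>"
  obtains (le) t where "\<beta> \<le> 1" "1 - real_of_ereal \<beta> = t" "0 \<le> t" "t \<le> 1"
  | (gt) t where "\<not> \<beta> \<le> 1" "1 - real_of_ereal (1 / \<beta>) = t" "0 \<le> t" "t \<le> 1"
proof (cases \<beta>)
  case (real r)
  show ?thesis
  proof (cases "r \<le> 1")
    case True
    then show ?thesis using real assms by (intro le[of "1 - r"]) auto
  next
    case False
    then show ?thesis using real assms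
      by (intro gt[of "1 - 1 / r"]) (auto simp: one_ereal_def)
  qed
next
  case PInf
  then show ?thesis by (intro gt[of 1]) auto
next
  case MInf
  then show ?thesis using assms by simp
qed

lemma diff_mult_pos:
  fixes mu x t :: real
  assumes "0 \<le> x" "x < mu" "0 \<le> t" "t \<le> 1"
  shows "0 < mu - x * t"
proof -
  have "x * t \<le> x" using assms by (simp add: mult_left_le)
  then show ?thesis using assms by linarith
qed

section \<open>Waiting times: conservation law and comparison with \<beta> = 0\<close>

definition total_wait :: "real \<Rightarrow> real \<Rightarrow> real \<Rightarrow> real" where
  "total_wait mu sigma l = l\<^sup>2 * psi mu sigma / (mu * (mu - l))"

text \<open>The factor with \<open>t\<close> cancels: with \<open>l = lp + ls\<close>, one has
  \<open>lp * (mu - l * t) + ls * mu = l * (mu - lp * t)\<close>, and symmetrically for \<beta> > 1.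
  What remains is \<open>l\<close> times the FCFS (Pollaczek-Khinchine) mean wait.\<close>

lemma conservation_law:
  assumes "0 < lp" "lp < mu" "0 \<le> ls" "ls < mu - lp" "0 \<le> \<beta>"
  shows "lp * W_p mu sigma lp ls \<beta> + ls * W_s mu sigma lp ls \<beta> = total_wait mu sigma (lp + ls)"
  using assms(5)
proof (cases \<beta> rule: parameter_cases)
  case (le t)
  have "mu - lp * t > 0" using assms le by (intro diff_mult_pos) auto
  moreover have "mu - (lp + ls) > 0" "mu > 0" using assms by auto
  ultimately show ?thesis
    unfolding W_p_def W_s_def total_wait_def Let_def le(2) using le(1)
    by (simp add: divide_simps) (simp add: algebra_simps power2_eq_square)
next
  case (gt t)
  have "mu - ls * t > 0" using assms gt by (intro diff_mult_pos) auto
  moreover have "mu - (lp + ls) > 0" "mu > 0" using assms by auto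
  ultimately show ?thesis
    unfolding W_p_def W_s_def total_wait_def Let_def gt(2) using gt(1)
    by (simp add: divide_simps) (simp add: algebra_simps power2_eq_square)
qed

text \<open>The factor \<open>mu - (lp + ls)\<close> cancels at \<beta> = 0, which leaves an
  expression affine in \<open>ls\<close>.\<close>

lemma W_p_zero:
  assumes "lp + ls < mu"
  shows "W_p mu sigma lp ls 0 = (lp + ls) * psi mu sigma / (mu * (mu - lp))"
  using assms unfolding W_p_def Let_def by simp

lemma W_p_infinity:
  "W_p mu sigma lp ls \<infinity> = (lp + ls) * psi mu sigma / ((mu - (lp + ls)) * (mu - ls))"
  unfolding W_p_def Let_def by simp

lemma W_p_ge_W_p_zero:
  assumes "0 < lp" "lp < mu" "0 \<le> ls" "ls < mu - lp" "0 \<le> \<beta>"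
  shows "W_p mu sigma lp ls 0 \<le> W_p mu sigma lp ls \<beta>"
proof -
  have lmu: "mu - (lp + ls) > 0" and mu: "mu > 0" and mlp: "mu - lp > 0" using assms by auto
  have num: "0 \<le> (lp + ls) * psi mu sigma" using assms psi_pos[of mu sigma] by simp
  have zero: "W_p mu sigma lp ls 0 = (lp + ls) * psi mu sigma / (mu * (mu - lp))"
    using assms by (intro W_p_zero) simp
  show ?thesis using assms(5)
  proof (cases \<beta> rule: parameter_cases)
    case (le t)
    have d: "mu - lp * t > 0" using assms le by (intro diff_mult_pos) auto
    \<comment> \<open>This is exactly the difference of the two cross products compared
      next.\<close>
    have "0 \<le> mu * ls * (1 - t)" using mu assms le by simp
    then have "(mu - (lp + ls)) * (mu - lp * t) \<le> (mu - (lp + ls) * t) * (mu - lp)"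
      by (simp add: algebra_simps)
    then have "1 / (mu - lp) \<le> (mu - (lp + ls) * t) / ((mu - (lp + ls)) * (mu - lp * t))"
      using d lmu mlp by (simp add: divide_simps)
    then have "(lp + ls) * psi mu sigma / mu * (1 / (mu - lp))
        \<le> (lp + ls) * psi mu sigma / mu * ((mu - (lp + ls) * t) / ((mu - (lp + ls)) * (mu - lp * t)))"
      using num mu by (intro mult_left_mono) auto
    then show ?thesis unfolding zero unfolding W_p_def Let_def le(2) using le(1) by (simp add: mult.assoc)
  next
    case (gt t)
    have d: "mu - ls * t > 0" using assms gt by (intro diff_mult_pos) auto
    \<comment> \<open>The numerators agree, so it suffices to compare the denominators factor by
      factor.\<close>
    have "(mu - (lp + ls)) * (mu - ls * t) \<le> (mu - lp) * mu"
      using assms gt d mu by (intro mult_mono) auto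
    then show ?thesis unfolding zero unfolding W_p_def Let_def gt(2) using gt(1) num d lmu mu mlp
      by (auto simp: mult.commute[of mu] intro!: divide_left_mono mult_pos_pos)
  qed
qed

lemma W_s_nonneg:
  assumes "0 < lp" "lp < mu" "0 \<le> ls" "ls < mu - lp" "0 \<le> \<beta>"
  shows "0 \<le> W_s mu sigma lp ls \<beta>"
  using assms(5)
proof (cases \<beta> rule: parameter_cases)
  case (le t)
  have "mu - lp * t > 0" using assms le by (intro diff_mult_pos) auto
  then show ?thesis unfolding W_s_def Let_def le(2) using le(1) assms psi_pos[of mu sigma] by simp
next
  case (gt t)
  have "mu - ls * t > 0" "mu - (lp + ls) * t > 0"
    using assms gt by (intro diff_mult_pos; simp)+
  then show ?thesis unfolding W_s_def Let_def gt(2) using gt(1) assms psi_pos[of mu sigma] by simp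
qed

section \<open>The revenue slope and the root of \<open>G\<close>\<close>

text \<open>The derivative of \<open>revenue_base\<close> in closed form; the arguments below use it
  purely algebraically.\<close>

definition revenue_slope :: "real \<Rightarrow> real \<Rightarrow> real \<Rightarrow> real \<Rightarrow> real \<Rightarrow> real \<Rightarrow> real" where
  "revenue_slope mu sigma lp a c x =
     a - 2 * x - c * psi mu sigma / mu * (mu\<^sup>2 / (mu - (lp + x))\<^sup>2 - 1)"

text \<open>Clearing the denominators of the slope produces the cubic, so on the stable range the
  roots of \<open>G\<close> are the zeros of the slope.\<close>

lemma G_eq_revenue_slope:
  assumes "0 < mu" "x < mu - lp"
  shows "G mu sigma lp a c x = - mu * (mu - (lp + x))\<^sup>2 * revenue_slope mu sigma lp a c x"
proof -
  define u where "u = mu - (lp + x)"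
  have u: "u > 0" and lp: "lp = mu - u - x" using assms by (auto simp: u_def)
  have "- mu * u\<^sup>2 * revenue_slope mu sigma lp a c x
      = - mu * u\<^sup>2 * (a - 2 * x) + c * psi mu sigma * (mu\<^sup>2 - u\<^sup>2)"
    unfolding revenue_slope_def u_def[symmetric] using u assms
    by (simp add: field_simps)
  also have "\<dots> = G mu sigma lp a c x"
    unfolding G_def Let_def lp by algebra
  finally show ?thesis unfolding u_def by simp
qed

lemma revenue_slope_strict_antimono:
  assumes "0 < mu" "0 < c" "x < y" "y < mu - lp"
  shows "revenue_slope mu sigma lp a c y < revenue_slope mu sigma lp a c x"
proof -
  have "mu\<^sup>2 / (mu - (lp + x))\<^sup>2 \<le> mu\<^sup>2 / (mu - (lp + y))\<^sup>2"
    using assms by (intro divide_left_mono power_mono mult_pos_pos zero_less_power) auto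
  then have "c * psi mu sigma / mu * (mu\<^sup>2 / (mu - (lp + x))\<^sup>2 - 1)
      \<le> c * psi mu sigma / mu * (mu\<^sup>2 / (mu - (lp + y))\<^sup>2 - 1)"
    using assms psi_pos[of mu sigma] by (intro mult_left_mono) auto
  then show ?thesis unfolding revenue_slope_def using assms by linarith
qed

text \<open>Existence follows from a sign change of \<open>G\<close> on [0, \<open>mu - lp\<close>],
  uniqueness from the strict decrease of the slope.\<close>

lemma ls1_root:
  assumes "0 < lp" "lp < mu" "0 < c"
    and "a / c > lp * (2 * mu - lp) / (mu * (mu - lp)\<^sup>2) * psi mu sigma"
  shows "0 < ls1 mu sigma lp a c \<and> ls1 mu sigma lp a c < mu - lp \<and>
         G mu sigma lp a c (ls1 mu sigma lp a c) = 0"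
  unfolding ls1_def
proof (rule theI')
  have mu: "mu > 0" and mlp: "mu - lp > 0" using assms by auto
  have zero: "G mu sigma lp a c 0 < 0"
  proof -
    \<comment> \<open>The hypothesis on \<open>a / c\<close> with denominators cleared is precisely
      negativity of \<open>G\<close> at 0.\<close>
    have "a * (mu * (mu - lp)\<^sup>2) > c * (lp * (2 * mu - lp) * psi mu sigma)"
      using assms(3,4) mu mlp by (simp add: field_simps)
    then show ?thesis unfolding G_def Let_def by (simp add: algebra_simps)
  qed
  have right: "G mu sigma lp a c (mu - lp) > 0"
  proof -
    have "G mu sigma lp a c (mu - lp) = c * psi mu sigma * mu\<^sup>2"
      unfolding G_def Let_def by algebra
    then show ?thesis using assms mu psi_pos[of mu sigma] by simp
  qed
  have "continuous_on {0..mu - lp} (G mu sigma lp a c)"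
    unfolding G_def Let_def by (intro continuous_intros)
  then obtain x where x: "0 \<le> x" "x \<le> mu - lp" "G mu sigma lp a c x = 0"
    using IVT'[of "G mu sigma lp a c" 0 0 "mu - lp"] zero right mlp by auto
  have root: "0 < x \<and> x < mu - lp \<and> G mu sigma lp a c x = 0"
    using x zero right by (cases "x = 0"; cases "x = mu - lp") auto
  have slope: "revenue_slope mu sigma lp a c y = 0"
    if "0 < y \<and> y < mu - lp \<and> G mu sigma lp a c y = 0" for y
    using that G_eq_revenue_slope[of mu y lp sigma a c] mu by auto
  show "\<exists>!x. 0 < x \<and> x < mu - lp \<and> G mu sigma lp a c x = 0"
  proof (rule ex1I[of _ x], rule root)
    fix y assume y: "0 < y \<and> y < mu - lp \<and> G mu sigma lp a c y = 0"
    show "y = x"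
      using slope[OF y] slope[OF root] root y mu assms(3)
        revenue_slope_strict_antimono[of mu c x y lp sigma a]
        revenue_slope_strict_antimono[of mu c y x lp sigma a]
      by (cases x y rule: linorder_cases) auto
  qed
qed

section \<open>Growth of the part of the revenue that is free of \<beta>\<close>

definition revenue_base :: "real \<Rightarrow> real \<Rightarrow> real \<Rightarrow> real \<Rightarrow> real \<Rightarrow> real \<Rightarrow> real" where
  "revenue_base mu sigma lp a c x = a * x - x\<^sup>2 - c * total_wait mu sigma (lp + x)"

text \<open>Since \<open>l\<^sup>2 / (mu - l) = mu\<^sup>2 / (mu - l) - mu - l\<close>, the
  difference quotient looks like the derivative, with a product of two denominators in place of the
  square.\<close>

lemma total_wait_diff:
  assumes "0 < mu" "x < mu" "y < mu"
  shows "total_wait mu sigma y - total_wait mu sigma x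
    = psi mu sigma / mu * (y - x) * (mu\<^sup>2 / ((mu - x) * (mu - y)) - 1)"
  unfolding total_wait_def using assms
  by (simp add: divide_simps) algebra

text \<open>The exact difference quotient between \<open>x\<close> and \<open>y\<close> exceeds the
  slope at \<open>y\<close>, so the sign of the slope at the right end point suffices.\<close>

lemma revenue_base_strict_mono:
  assumes "0 < lp" "lp < mu" "0 < c" "0 \<le> x" "x < y" "y < mu - lp"
    and slope: "0 \<le> revenue_slope mu sigma lp a c y"
  shows "revenue_base mu sigma lp a c x < revenue_base mu sigma lp a c y"
proof -
  let ?k = "c * psi mu sigma / mu"
  let ?q = "mu\<^sup>2 / ((mu - (lp + x)) * (mu - (lp + y)))"
  have "?q \<le> mu\<^sup>2 / (mu - (lp + y))\<^sup>2"
    unfolding power2_eq_square[of "mu - (lp + y)"]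
    using assms by (intro divide_left_mono mult_right_mono mult_pos_pos) auto
  then have "?k * (?q - 1) \<le> ?k * (mu\<^sup>2 / (mu - (lp + y))\<^sup>2 - 1)"
    using assms psi_pos[of mu sigma] by (intro mult_left_mono) auto
  \<comment> \<open>Strictness comes from \<open>a - x - y > a - 2 * y\<close>.\<close>
  then have "0 < a - x - y - ?k * (?q - 1)"
    using slope assms unfolding revenue_slope_def by linarith
  then have "0 < (y - x) * (a - x - y - ?k * (?q - 1))" using assms by simp
  also have "\<dots> = (y - x) * (a - x - y) - c * (psi mu sigma / mu * (y - x) * (?q - 1))"
    by (simp add: algebra_simps)
  also have "psi mu sigma / mu * (y - x) * (?q - 1)
      = total_wait mu sigma (lp + y) - total_wait mu sigma (lp + x)"
    using total_wait_diff[of mu "lp + x" "lp + y" sigma] assms by simp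
  also have "(y - x) * (a - x - y) - c * \<dots>
      = revenue_base mu sigma lp a c y - revenue_base mu sigma lp a c x"
    unfolding revenue_base_def by (simp add: algebra_simps power2_eq_square)
  finally show ?thesis by simp
qed

lemma revenue_eq:
  assumes "0 < lp" "lp < mu" "0 \<le> ls" "ls < mu - lp" "0 \<le> \<beta>"
  shows "P1_objective mu sigma lp a b c (ls, \<beta>)
    = (revenue_base mu sigma lp a c ls + c * lp * W_p mu sigma lp ls \<beta>) / b"
proof -
  have "c * (ls * W_s mu sigma lp ls \<beta>)
      = c * (total_wait mu sigma (lp + ls) - lp * W_p mu sigma lp ls \<beta>)"
    using conservation_law[OF assms, of sigma] by simp
  then have "a * ls - ls\<^sup>2 - c * ls * W_s mu sigma lp ls \<beta>
      = revenue_base mu sigma lp a c ls + c * lp * W_p mu sigma lp ls \<beta>"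
    unfolding revenue_base_def by (simp add: algebra_simps)
  then show ?thesis unfolding P1_objective_def by simp
qed

section \<open>Optimal values and the comparison of the three problems\<close>

text \<open>The claim on P0 concerns every optimum of P1; this transfers the value computed at one
  optimum to all others.\<close>

lemma is_arg_max_value_eq:
  fixes f :: "'x \<Rightarrow> 'y::linorder"
  assumes "is_arg_max f P x" "is_arg_max f P y"
  shows "f x = f y"
  using assms unfolding is_arg_max_linorder by (meson antisym)

lemma optimal_value_eq:
  assumes "optimal_solution f X x"
  shows "optimal_value f X = ereal (f x)"
  using assms unfolding optimal_value_def optimal_solution_def is_arg_max_linorder
  by (intro antisym SUP_least SUP_upper) auto

theorem theorem3p2:
  fixes mu sigma lp a b c Sp :: real
  assumes "0 < lp" and "lp < mu" and "0 \<le> sigma"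
    and "0 < a" and "0 < b" and "0 < c"
    and "a / c > lp * (2 * mu - lp) / (mu * (mu - lp)\<^sup>2) * psi mu sigma"
    and "Sp \<in> I_minus mu sigma lp a c"
  shows "optimal_value (P1_objective mu sigma lp a b c) (P1_feasible mu sigma lp Sp)
           > optimal_value (P2_objective mu sigma lp a b c) (P2_feasible mu sigma lp Sp)
       \<and> (\<exists>ls \<beta>. optimal_solution (P1_objective mu sigma lp a b c) (P1_feasible mu sigma lp Sp) (ls, \<beta>))
       \<and> (\<forall>ls \<beta>. optimal_solution (P1_objective mu sigma lp a b c) (P1_feasible mu sigma lp Sp) (ls, \<beta>) \<longrightarrow>
            (let Ss = W_s mu sigma lp ls \<beta>; \<theta> = (a - ls - c * Ss) / b
             in optimal_solution P0_objective (P0_feasible mu sigma lp a b c Sp) (ls, \<beta>, Ss, \<theta>)))"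
proof -
  note par = assms(1,2)
  let ?f = "P1_objective mu sigma lp a b c" and ?F = "revenue_base mu sigma lp a c"
  define r where "r = ls1 mu sigma lp a c"
  define s where "s = Sp * mu * (mu - lp) / psi mu sigma - lp"
  have mu: "mu > 0" using par by simp
  note psi = psi_pos[of mu sigma]
  have r: "0 < r" "r < mu - lp" "G mu sigma lp a c r = 0"
    using ls1_root[OF par assms(6,7)] by (auto simp: r_def)
  have Sp: "Sp = (lp + s) * psi mu sigma / (mu * (mu - lp))"
    unfolding s_def using mu par psi by simp
  \<comment> \<open>\<open>S_hat\<close>, \<open>Sp\<close> and \<open>I_l\<close> are the values of
    one increasing affine function at 0, \<open>s\<close> and \<open>r\<close>.\<close>
  have "0 < s" "s < r"
    using assms(8) mu par psi unfolding I_minus_def I_l_def S_hat_def r_def[symmetric] Sp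
    by (auto simp: divide_less_cancel)
  then have s: "0 < s" "s < r" "s < mu - lp" using r by auto
  have r_slope: "revenue_slope mu sigma lp a c r = 0"
    using r G_eq_revenue_slope[of mu r lp sigma a c] mu by auto
  \<comment> \<open>The slope vanishes at \<open>r\<close> and strictly decreases, so it is positive
    at \<open>y \<le> s < r\<close>.\<close>
  have F_less: "?F x < ?F y" if "0 \<le> x" "x < y" "y \<le> s" for x y
    using that s r par assms(6) r_slope mu
      revenue_slope_strict_antimono[of mu c y r lp sigma a]
    by (intro revenue_base_strict_mono) auto
  have ls_le: "ls \<le> s"
    if "W_p mu sigma lp ls \<beta> \<le> Sp" "0 \<le> ls" "ls < mu - lp" "0 \<le> \<beta>" for ls \<beta>
  proof -
    have "W_p mu sigma lp ls 0 \<le> Sp" using W_p_ge_W_p_zero[OF par that(2-4), of sigma] that(1) by simp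
    then show ?thesis using that mu par psi unfolding Sp
      by (simp add: W_p_zero divide_le_cancel)
  qed
  have f_le: "?f (ls, \<beta>) \<le> (?F ls + c * lp * Sp) / b"
    if "W_p mu sigma lp ls \<beta> \<le> Sp" "0 \<le> ls" "ls < mu - lp" "0 \<le> \<beta>" for ls \<beta>
    using that assms(5,6) par unfolding revenue_eq[OF par that(2-4)]
    by (intro divide_right_mono add_left_mono mult_left_mono) auto
  have W_p_s: "W_p mu sigma lp s 0 = Sp"
    unfolding Sp using s by (intro W_p_zero) simp
  have f_s: "?f (s, 0) = (?F s + c * lp * Sp) / b"
    using revenue_eq[OF par, of s 0] s W_p_s by simp
  \<comment> \<open>The bound includes \<beta> = \<infinity>, which P0 admits although P1 does
    not.\<close>
  have f_max: "?f (ls, \<beta>) \<le> ?f (s, 0)"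
    if feas: "W_p mu sigma lp ls \<beta> \<le> Sp" "0 \<le> ls" "ls < mu - lp" "0 \<le> \<beta>" for ls \<beta>
  proof -
    have "?F ls \<le> ?F s" using F_less[of ls s] ls_le[OF feas] that by (cases "ls = s") auto
    then have "(?F ls + c * lp * Sp) / b \<le> ?f (s, 0)"
      unfolding f_s using assms(5) by (simp add: divide_right_mono)
    then show ?thesis using f_le[OF feas] by linarith
  qed
  have opt: "optimal_solution ?f (P1_feasible mu sigma lp Sp) (s, 0)"
    unfolding optimal_solution_def is_arg_max_linorder
    using s W_p_s f_max by (auto simp: P1_feasible_def)
  \<comment> \<open>Positivity of the optimal revenue later yields a nonnegative price. Already
    \<open>?F 0 + c * lp * Sp\<close> equals \<open>c * lp\<close> times the positive gap between
    \<open>Sp\<close> and \<open>S_hat\<close>.\<close>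
  have f_pos: "0 < ?f (s, 0)"
  proof -
    have "?F 0 + c * lp * Sp = c * lp * (psi mu sigma * s / (mu * (mu - lp)))"
      unfolding revenue_base_def total_wait_def Sp using mu par
      by (simp add: divide_simps) algebra
    also have "\<dots> > 0" using s mu par assms(6) psi by simp
    finally have "0 < ?F s + c * lp * Sp" using F_less[of 0 s] s by simp
    then show ?thesis unfolding f_s using assms(5) by simp
  qed
  have P1_gt_P2: "optimal_value ?f (P1_feasible mu sigma lp Sp)
      > optimal_value (P2_objective mu sigma lp a b c) (P2_feasible mu sigma lp Sp)"
  proof -
    \<comment> \<open>Weakening \<open>mu - (lp + ls)\<close> to \<open>mu - lp\<close> in the
      constraint at \<beta> = \<infinity> makes it linear in \<open>ls\<close>, with solution
      \<open>ls \<le> v\<close>. A fixed \<open>v < s\<close> keeps the inequality strict for the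
      supremum.\<close>
    define v where "v = mu * s / (mu + lp + s)"
    have v: "0 \<le> v" "v < s" unfolding v_def using s mu par by (auto simp: field_simps add_pos_pos)
    have "P2_objective mu sigma lp a b c ls \<le> (?F v + c * lp * Sp) / b"
      if "ls \<in> P2_feasible mu sigma lp Sp" for ls
    proof -
      have ls: "W_p mu sigma lp ls \<infinity> \<le> Sp" "0 \<le> ls" "ls < mu - lp"
        using that by (auto simp: P2_feasible_def)
      have "(lp + ls) * psi mu sigma / ((mu - lp) * (mu - ls)) \<le> W_p mu sigma lp ls \<infinity>"
        unfolding W_p_infinity using ls par psi
        by (intro divide_left_mono mult_right_mono mult_pos_pos mult_nonneg_nonneg) auto
      also have "\<dots> \<le> (lp + s) * psi mu sigma / (mu * (mu - lp))" using ls Sp by simp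
      finally have "(lp + ls) * mu \<le> (lp + s) * (mu - ls)"
        using ls mu par psi by (simp add: divide_simps)
      then have "ls \<le> v" unfolding v_def using mu par s by (simp add: field_simps)
      then have "?F ls \<le> ?F v" using F_less[of ls v] ls v by (cases "ls = v") auto
      then have "(?F ls + c * lp * Sp) / b \<le> (?F v + c * lp * Sp) / b"
        using assms(5) by (simp add: divide_right_mono)
      moreover have "P2_objective mu sigma lp a b c ls = ?f (ls, \<infinity>)"
        by (simp add: P2_objective_def P1_objective_def)
      ultimately show ?thesis using f_le[OF ls] by simp
    qed
    then have "optimal_value (P2_objective mu sigma lp a b c) (P2_feasible mu sigma lp Sp)
        \<le> ereal ((?F v + c * lp * Sp) / b)"
      unfolding optimal_value_def by (intro SUP_least) simp
    also have "\<dots> < ereal (?f (s, 0))"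
      unfolding f_s using F_less[of v s] v assms(5) by (simp add: divide_strict_right_mono)
    finally show ?thesis unfolding optimal_value_eq[OF opt] .
  qed
  have P0_opt: "optimal_solution P0_objective (P0_feasible mu sigma lp a b c Sp)
      (ls, \<beta>, W_s mu sigma lp ls \<beta>, (a - ls - c * W_s mu sigma lp ls \<beta>) / b)"
    if sol: "optimal_solution ?f (P1_feasible mu sigma lp Sp) (ls, \<beta>)" for ls \<beta>
  proof -
    have feas: "W_p mu sigma lp ls \<beta> \<le> Sp" "0 \<le> ls" "ls < mu - lp" "0 \<le> \<beta>"
      using sol by (auto simp: optimal_solution_def is_arg_max_def P1_feasible_def)
    let ?W = "W_s mu sigma lp ls \<beta>"
    have val: "?f (ls, \<beta>) = ?f (s, 0)"
      using sol opt unfolding optimal_solution_def by (rule is_arg_max_value_eq)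
    \<comment> \<open>The objective of P1 is price times rate, at the price that makes the demand
      bound tight when the offered service level is \<open>W_s\<close>.\<close>
    have f_prod: "?f (l, \<gamma>) = (a - l - c * W_s mu sigma lp l \<gamma>) / b * l" for l \<gamma>
      by (simp add: P1_objective_def left_diff_distrib right_diff_distrib diff_divide_distrib
          power2_eq_square mult_ac)
    have "0 < (a - ls - c * ?W) / b * ls" using f_pos val f_prod[of ls \<beta>] by linarith
    then have theta: "0 \<le> (a - ls - c * ?W) / b"
      using feas(2) unfolding zero_less_mult_iff by linarith
    have point: "(ls, \<beta>, ?W, (a - ls - c * ?W) / b) \<in> P0_feasible mu sigma lp a b c Sp"
      unfolding P0_feasible_def using feas theta W_s_nonneg[OF par feas(2-4)] assms(5) by simp
    have "P0_objective y \<le> ?f (s, 0)" if y: "y \<in> P0_feasible mu sigma lp a b c Sp" for y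
    proof -
      obtain l \<gamma> S \<theta> where y_eq: "y = (l, \<gamma>, S, \<theta>)" by (cases y)
      have l: "W_p mu sigma lp l \<gamma> \<le> Sp" "0 \<le> l" "l < mu - lp" "0 \<le> \<gamma>"
        and S: "W_s mu sigma lp l \<gamma> \<le> S" "l \<le> a - b * \<theta> - c * S"
        using y unfolding y_eq P0_feasible_def by auto
      \<comment> \<open>Lowering the offered level from \<open>S\<close> to \<open>W_s\<close> only
        relaxes the demand bound on the price, so every point of P0 earns at most
        \<open>?f (l, \<gamma>)\<close>.\<close>
      have "c * W_s mu sigma lp l \<gamma> \<le> c * S" using S assms(6) by simp
      then have "\<theta> \<le> (a - l - c * W_s mu sigma lp l \<gamma>) / b"
        using S assms(5) by (simp add: field_simps)
      then have "\<theta> * l \<le> ?f (l, \<gamma>)" unfolding f_prod using l by (intro mult_right_mono)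
      also have "\<dots> \<le> ?f (s, 0)" using l by (rule f_max)
      finally show ?thesis by (simp add: y_eq P0_objective_def)
    qed
    moreover have "P0_objective (ls, \<beta>, ?W, (a - ls - c * ?W) / b) = ?f (s, 0)"
      using val f_prod[of ls \<beta>] by (simp add: P0_objective_def del: times_divide_eq_left)
    ultimately show ?thesis
      unfolding optimal_solution_def is_arg_max_linorder using point by auto
  qed
  show ?thesis
    using P1_gt_P2 opt P0_opt unfolding Let_def by blast
qed

end
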